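(* The relation $\stackrel{\curlywedge}{\approx}_\alpha$ coincides with $\approx_\alpha$ on ground terms: for all ground nominal terms $s,t$ (terms without variables), $\emptyset\vdash s\approx_\alpha t$ if and only if $\emptyset\vdash s\stackrel{\curlywedge}{\approx}_\alpha t$. More generally, for all nominal terms $s,t$: (1) for every freshness context $\Delta$, if $\Delta\vdash s\approx_\alpha t$ then $[\Delta]_{\curlywedge}\vdash s\stackrel{\curlywedge}{\approx}_\alpha t$; (2) for every fixed-point context $\Upsilon$ and every list $\overline c$ of newly quantified atoms, if $\Upsilon\vdash\mathsf{N}\overline c.\,s\stackrel{\curlywedge}{\approx}_\alpha t$ then $[\Upsilon]_{\#}\cup\Delta\vdash s\approx_\alpha t$ for any freshness context $\Delta$ such that $\Delta\vdash c\# X$ for every $c\in\overline c$ and every variable $X$ occurring in $s$ or $t$.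
   Context: **Syntax.** Fix a countably infinite set $\mathbb{A}$ of atoms $a,b,c,\dots$ (distinct letters denote distinct atoms), a countably infinite set of variables $X,Y,\dots$, and a countable set of function symbols. A permutation is a bijection $\pi:\mathbb{A}\to\mathbb{A}$ with $\mathrm{supp}(\pi)=\{a\mid\pi(a)\neq a\}$ finite; $(a\ b)$ is a swapping. Nominal terms: $s,t::=a\mid[a]t\mid(t_1,\dots,t_n)\mid f\,t\mid\pi\cdot X$ (not quotiented by $\alpha$-renaming; $X$ abbreviates $Id\cdot X$). Permutation action: $\pi\cdot a=\pi(a)$, $\pi\cdot[a]t=[\pi(a)](\pi\cdot t)$, $\pi\cdot(\pi'\cdot X)=(\pi\circ\pi')\cdot X$, and componentwise on tuples and applications. Conjugate: $\pi^{\rho}=\rho\circ\pi\circ\rho^{-1}$. **Freshness approach.** A freshness context $\Delta$ is a finite set of constraints $a\# X$. Rules for $\Delta\vdash a\# t$: $\Delta\vdash a\# b$ for $a\neq b$; $\Delta\vdash a\#\pi\cdot X$ if $\pi^{-1}(a)\# X\in\Delta$; $\Delta\vdash a\# f\,t$ if $\Delta\vdash a\# t$; $\Delta\vdash a\#(t_1,\dots,t_n)$ if $\Delta\vdash a\# t_i$ for all $i$; $\Delta\vdash a\#[a]t$; $\Delta\vdash a\#[b]t$ if $a\ne b$ and $\Delta\vdash a\# t$. Rules for $\Delta\vdash s\approx_\alpha t$: $\Delta\vdash a\approx_\alpha a$; $\Delta\vdash\pi\cdot X\approx_\alpha\pi'\cdot X$ if $a\# X\in\Delta$ for every $a$ with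 $\pi(a)\neq\pi'(a)$; congruence for $f$ and for tuples of the same length; from $\Delta\vdash t\approx_\alpha t'$ infer $\Delta\vdash[a]t\approx_\alpha[a]t'$; from $\Delta\vdash s\approx_\alpha(a\ b)\cdot t$ and $\Delta\vdash a\# t$ infer $\Delta\vdash[a]s\approx_\alpha[b]t$ ($a\neq b$). **Fixed-point approach.** A fixed-point context $\Upsilon$ is a finite set of constraints $\pi\curlywedge X$. Put $\mathrm{supp}(\mathrm{perm}(\Upsilon|_X))=\bigcup\{\mathrm{supp}(\pi)\mid\pi\curlywedge X\in\Upsilon\}$. In judgements, $\overline c$ is a finite, possibly empty, list of newly quantified atoms ($\mathsf N$ is the nominal "new" quantifier, omitted when $\overline c$ is empty). Rules for $\Upsilon\vdash\mathsf{N}\overline c.\,\pi\curlywedge t$: - $\Upsilon\vdash\mathsf{N}\overline c.\,\pi\curlywedge a$ if $\pi(a)=a$; - $\Upsilon\vdash\mathsf{N}\overline c.\,\pi\curlywedge\pi'\cdot X$ if $\mathrm{supp}(\pi^{\pi'^{-1}})\setminus\{\overline c\}\subseteq\mathrm{supp}(\mathrm{perm}(\Upsilon|_X))$; - from $\Upsilon\vdash\mathsf{N}\overline c.\,\pi\curlywedge t$ infer $\Upsilon\vdash\mathsf{N}\overline c.\,\pi\curlywedge f\,t$; - from $\Upsilon\vdash\mathsf{N}\overline c.\,\pi\curlywedge t_i$ for all $i$ infer $\Upsilon\vdash\mathsf{N}\overline c.\,\pi\curlywedge(t_1,\dots,t_n)$; - from $\Upsilon\vdash\mathsf{N}\overline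 c,c_1.\,\pi\curlywedge(a\ c_1)\cdot t$ infer $\Upsilon\vdash\mathsf{N}\overline c.\,\pi\curlywedge[a]t$, with $c_1$ a new atom not occurring in the conclusion. Rules for $\Upsilon\vdash\mathsf{N}\overline c.\,s\stackrel{\curlywedge}{\approx}_\alpha t$: - $\Upsilon\vdash\mathsf{N}\overline c.\,a\stackrel{\curlywedge}{\approx}_\alpha a$; - $\Upsilon\vdash\mathsf{N}\overline c.\,\pi\cdot X\stackrel{\curlywedge}{\approx}_\alpha\pi'\cdot X$ if $\mathrm{supp}((\pi')^{-1}\circ\pi)\setminus\{\overline c\}\subseteq\mathrm{supp}(\mathrm{perm}(\Upsilon|_X))$; - congruence (same $\overline c$) for $f$, for tuples of the same length, and for abstractions $[a]t,[a]t'$ of the same atom; - from $\Upsilon\vdash\mathsf{N}\overline c.\,s\stackrel{\curlywedge}{\approx}_\alpha(a\ b)\cdot t$ and $\Upsilon\vdash\mathsf{N}\overline c,c_1.\,(a\ c_1)\curlywedge t$ infer $\Upsilon\vdash\mathsf{N}\overline c.\,[a]s\stackrel{\curlywedge}{\approx}_\alpha[b]t$ ($a\neq b$, $c_1$ a new atom not occurring in the conclusion). **Translations.** $[\Delta]_{\curlywedge}=\{(a\ c_a)\curlywedge X\mid a\# X\in\Delta\}$ where each $c_a$ is a new atom (occurring nowhere else in the judgements considered). $[\Upsilon]_{\#}=\{a\# X\mid \pi\curlywedge X\in\Upsilon,\ a\in\mathrm{supp}(\pi)\}$. *)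

theory Defs
  imports
    "HOL-Combinatorics.Perm"
    "HOL-Library.Countable"
    "HOL-Library.Infinite_Typeclass"
begin

unbundle permutation_syntax

text \<open>
  Atoms, variables and function symbols are the type parameters \<open>'a\<close>, \<open>'x\<close>, \<open>'f\<close>.
  Finitely supported permutations are \<open>'a perm\<close>, with support \<open>affected\<close>
  and composition \<open>*\<close>. Terms are raw syntax, not quotiented by renaming.
\<close>

datatype ('a, 'x, 'f) trm =
    Atm 'a
  | Abst 'a "('a, 'x, 'f) trm"
  | Tup "('a, 'x, 'f) trm list"
  | Fun 'f "('a, 'x, 'f) trm"
  | Susp "'a perm" 'x

fun vars :: "('a, 'x, 'f) trm \<Rightarrow> 'x set" where
  "vars (Atm a) = {}"
| "vars (Abst a t) = vars t"
| "vars (Tup ts) = (\<Union>t\<in>set ts. vars t)"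
| "vars (Fun f t) = vars t"
| "vars (Susp p X) = {X}"

definition ground :: "('a, 'x, 'f) trm \<Rightarrow> bool" where
  "ground t \<longleftrightarrow> vars t = {}"

text \<open>All atoms occurring in the syntax, including abstracted ones.\<close>

fun atoms :: "('a, 'x, 'f) trm \<Rightarrow> 'a set" where
  "atoms (Atm a) = {a}"
| "atoms (Abst a t) = insert a (atoms t)"
| "atoms (Tup ts) = (\<Union>t\<in>set ts. atoms t)"
| "atoms (Fun f t) = atoms t"
| "atoms (Susp p X) = affected p"

fun act :: "'a perm \<Rightarrow> ('a, 'x, 'f) trm \<Rightarrow> ('a, 'x, 'f) trm" (infixr \<open>\<bullet>\<close> 75) where
  "p \<bullet> Atm a = Atm (p \<langle>$\<rangle> a)"
| "p \<bullet> Abst a t = Abst (p \<langle>$\<rangle> a) (p \<bullet> t)"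
| "p \<bullet> Tup ts = Tup (map (act p) ts)"
| "p \<bullet> Fun f t = Fun f (p \<bullet> t)"
| "p \<bullet> Susp q X = Susp (p * q) X"

definition conjugate :: "'a perm \<Rightarrow> 'a perm \<Rightarrow> 'a perm" where
  "conjugate p r = r * p * inverse r"


subsection \<open>Freshness approach\<close>

type_synonym ('a, 'x) fresh_ctx = "('a \<times> 'x) set"

inductive fresh :: "('a, 'x) fresh_ctx \<Rightarrow> 'a \<Rightarrow> ('a, 'x, 'f) trm \<Rightarrow> bool"
  for \<Delta> :: "('a, 'x) fresh_ctx" where
  fresh_Atm: "a \<noteq> b \<Longrightarrow> fresh \<Delta> a (Atm b)"
| fresh_Susp: "(inverse p \<langle>$\<rangle> a, X) \<in> \<Delta> \<Longrightarrow> fresh \<Delta> a (Susp p X)"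
| fresh_Fun: "fresh \<Delta> a t \<Longrightarrow> fresh \<Delta> a (Fun f t)"
| fresh_Tup: "\<forall>t\<in>set ts. fresh \<Delta> a t \<Longrightarrow> fresh \<Delta> a (Tup ts)"
| fresh_Abst_same: "fresh \<Delta> a (Abst a t)"
| fresh_Abst_diff: "a \<noteq> b \<Longrightarrow> fresh \<Delta> a t \<Longrightarrow> fresh \<Delta> a (Abst b t)"

inductive alpha_fresh ::
  "('a, 'x) fresh_ctx \<Rightarrow> ('a, 'x, 'f) trm \<Rightarrow> ('a, 'x, 'f) trm \<Rightarrow> bool"
  for \<Delta> :: "('a, 'x) fresh_ctx" where
  alpha_fresh_Atm: "alpha_fresh \<Delta> (Atm a) (Atm a)"
| alpha_fresh_Susp:
    "\<forall>a. p \<langle>$\<rangle> a \<noteq> q \<langle>$\<rangle> a \<longrightarrow> (a, X) \<in> \<Delta> \<Longrightarrow> alpha_fresh \<Delta> (Susp p X) (Susp q X)"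
| alpha_fresh_Fun: "alpha_fresh \<Delta> s t \<Longrightarrow> alpha_fresh \<Delta> (Fun f s) (Fun f t)"
| alpha_fresh_Tup: "list_all2 (alpha_fresh \<Delta>) ss ts \<Longrightarrow> alpha_fresh \<Delta> (Tup ss) (Tup ts)"
| alpha_fresh_Abst_same: "alpha_fresh \<Delta> s t \<Longrightarrow> alpha_fresh \<Delta> (Abst a s) (Abst a t)"
| alpha_fresh_Abst_diff:
    "a \<noteq> b \<Longrightarrow> alpha_fresh \<Delta> s (\<langle>a \<leftrightarrow> b\<rangle> \<bullet> t) \<Longrightarrow> fresh \<Delta> a t
      \<Longrightarrow> alpha_fresh \<Delta> (Abst a s) (Abst b t)"


subsection \<open>Fixed-point approach\<close>

type_synonym ('a, 'x) fix_ctx = "('a perm \<times> 'x) set"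

definition supp_ctx :: "('a, 'x) fix_ctx \<Rightarrow> 'x \<Rightarrow> 'a set" where
  "supp_ctx \<Upsilon> X = \<Union> {affected p | p. (p, X) \<in> \<Upsilon>}"

definition atoms_ctx :: "('a, 'x) fix_ctx \<Rightarrow> 'a set" where
  "atoms_ctx \<Upsilon> = (\<Union>(p, X)\<in>\<Upsilon>. affected p)"

text \<open>
  The list argument \<open>cs\<close> holds the newly quantified atoms. The conditions on \<open>c\<close> in the
  abstraction rules say that it occurs nowhere in the conclusion: neither in the context,
  nor in the quantifier prefix, the permutation or the terms.
\<close>

inductive fixpt ::
  "('a, 'x) fix_ctx \<Rightarrow> 'a list \<Rightarrow> 'a perm \<Rightarrow> ('a, 'x, 'f) trm \<Rightarrow> bool"
  for \<Upsilon> :: "('a, 'x) fix_ctx" where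
  fixpt_Atm: "p \<langle>$\<rangle> a = a \<Longrightarrow> fixpt \<Upsilon> cs p (Atm a)"
| fixpt_Susp:
    "affected (conjugate p (inverse q)) - set cs \<subseteq> supp_ctx \<Upsilon> X \<Longrightarrow> fixpt \<Upsilon> cs p (Susp q X)"
| fixpt_Fun: "fixpt \<Upsilon> cs p t \<Longrightarrow> fixpt \<Upsilon> cs p (Fun f t)"
| fixpt_Tup: "\<forall>t\<in>set ts. fixpt \<Upsilon> cs p t \<Longrightarrow> fixpt \<Upsilon> cs p (Tup ts)"
| fixpt_Abst:
    "fixpt \<Upsilon> (cs @ [c]) p (\<langle>a \<leftrightarrow> c\<rangle> \<bullet> t)
      \<Longrightarrow> c \<notin> atoms_ctx \<Upsilon> \<union> set cs \<union> affected p \<union> atoms (Abst a t)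
      \<Longrightarrow> fixpt \<Upsilon> cs p (Abst a t)"

inductive alpha_fix ::
  "('a, 'x) fix_ctx \<Rightarrow> 'a list \<Rightarrow> ('a, 'x, 'f) trm \<Rightarrow> ('a, 'x, 'f) trm \<Rightarrow> bool"
  for \<Upsilon> :: "('a, 'x) fix_ctx" where
  alpha_fix_Atm: "alpha_fix \<Upsilon> cs (Atm a) (Atm a)"
| alpha_fix_Susp:
    "affected (inverse q * p) - set cs \<subseteq> supp_ctx \<Upsilon> X
      \<Longrightarrow> alpha_fix \<Upsilon> cs (Susp p X) (Susp q X)"
| alpha_fix_Fun: "alpha_fix \<Upsilon> cs s t \<Longrightarrow> alpha_fix \<Upsilon> cs (Fun f s) (Fun f t)"
| alpha_fix_Tup: "list_all2 (alpha_fix \<Upsilon> cs) ss ts \<Longrightarrow> alpha_fix \<Upsilon> cs (Tup ss) (Tup ts)"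
| alpha_fix_Abst_same: "alpha_fix \<Upsilon> cs s t \<Longrightarrow> alpha_fix \<Upsilon> cs (Abst a s) (Abst a t)"
| alpha_fix_Abst_diff:
    "a \<noteq> b \<Longrightarrow> alpha_fix \<Upsilon> cs s (\<langle>a \<leftrightarrow> b\<rangle> \<bullet> t)
      \<Longrightarrow> fixpt \<Upsilon> (cs @ [c]) \<langle>a \<leftrightarrow> c\<rangle> t
      \<Longrightarrow> c \<notin> atoms_ctx \<Upsilon> \<union> set cs \<union> atoms (Abst a s) \<union> atoms (Abst b t)
      \<Longrightarrow> alpha_fix \<Upsilon> cs (Abst a s) (Abst b t)"


subsection \<open>Translations\<close>

text \<open>
  The choice \<open>a \<mapsto> c\<^sub>a\<close> of new atoms is an explicit parameter, and \<open>new_atoms\<close> says that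
  a choice is admissible for a judgement with context \<open>\<Delta>\<close> and terms \<open>s\<close>, \<open>t\<close>: the chosen
  atoms are pairwise distinct and occur neither in \<open>\<Delta>\<close> nor in \<open>s\<close>, \<open>t\<close>.
\<close>

definition new_atoms ::
  "('a \<Rightarrow> 'a) \<Rightarrow> ('a, 'x) fresh_ctx \<Rightarrow> ('a, 'x, 'f) trm \<Rightarrow> ('a, 'x, 'f) trm \<Rightarrow> bool" where
  "new_atoms c \<Delta> s t \<longleftrightarrow>
     inj_on c (fst ` \<Delta>) \<and> c ` fst ` \<Delta> \<inter> (fst ` \<Delta> \<union> atoms s \<union> atoms t) = {}"

definition to_fix :: "('a \<Rightarrow> 'a) \<Rightarrow> ('a, 'x) fresh_ctx \<Rightarrow> ('a, 'x) fix_ctx" where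
  "to_fix c \<Delta> = {(\<langle>a \<leftrightarrow> c a\<rangle>, X) | a X. (a, X) \<in> \<Delta>}"

definition to_fresh :: "('a, 'x) fix_ctx \<Rightarrow> ('a, 'x) fresh_ctx" where
  "to_fresh \<Upsilon> = {(a, X) | a p X. (p, X) \<in> \<Upsilon> \<and> a \<in> affected p}"

end

theory Submission
  imports Defs
begin

text \<open>
  A fixed-point context \<open>\<Upsilon>\<close> together with newly quantified atoms \<open>cs\<close> behaves exactly like the
  freshness context that declares every atom of \<open>supp_ctx \<Upsilon> X\<close> and of \<open>cs\<close> fresh for \<open>X\<close>:
  under this reading \<open>p\<close> fixes \<open>t\<close> iff all atoms moved by \<open>p\<close> are fresh for \<open>t\<close>, and the two
  alpha-equivalences are the same relation. Both translations then follow by changing the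
  freshness context on the variables that occur in the terms.
\<close>

definition fresh_of_fix :: "('a, 'x) fix_ctx \<Rightarrow> 'a list \<Rightarrow> ('a, 'x) fresh_ctx" where
  "fresh_of_fix \<Upsilon> cs = {(a, X). a \<in> supp_ctx \<Upsilon> X \<or> a \<in> set cs}"

inductive_simps fresh_simps [simp]:
  "fresh \<Delta> a (Atm b)"
  "fresh \<Delta> a (Susp p X)"
  "fresh \<Delta> a (Fun f t)"
  "fresh \<Delta> a (Tup ts)"
  "fresh \<Delta> a (Abst b t)"

lemma vars_act [simp]: "vars (p \<bullet> t) = vars t"
  by (induction t) auto

lemma finite_atoms: "finite (atoms t)"
  by (induction t) auto

lemma act_act: "p \<bullet> q \<bullet> t = (p * q) \<bullet> t"
  by (induction t) (auto simp: apply_times mult.assoc)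

lemma act_1 [simp]: "1 \<bullet> t = t"
  by (induction t) (auto simp: map_idI)

lemma inverse_apply_eq_iff [simp]:
  "inverse p \<langle>$\<rangle> a = b \<longleftrightarrow> p \<langle>$\<rangle> b = a"
  "b = inverse p \<langle>$\<rangle> a \<longleftrightarrow> p \<langle>$\<rangle> b = a"
  by (metis apply_sequence apply_one id_apply perm.left_inverse)+

lemma apply_inverse_cancel [simp]:
  "p \<langle>$\<rangle> (inverse p \<langle>$\<rangle> a) = a"
  "inverse p \<langle>$\<rangle> (p \<langle>$\<rangle> a) = a"
  by (simp_all add: apply_sequence)

text \<open>Suspensions collect the permutation and their freshness rule inverts it, so
  \<open>p\<close> acts on the atom alone and \<open>\<Delta>\<close> is not permuted.\<close>

lemma fresh_act: "fresh \<Delta> a (p \<bullet> t) \<longleftrightarrow> fresh \<Delta> (inverse p \<langle>$\<rangle> a) t"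
  by (induction t) (auto simp: apply_times)

text \<open>Comparing contexts only on \<open>vars t\<close> matters for the translation to
  freshness, where atoms of \<open>cs\<close> are assumed fresh just for variables of the
  terms.\<close>

lemma fresh_weaken:
  assumes "fresh \<Delta> a t" "\<And>b X. (b, X) \<in> \<Delta> \<Longrightarrow> X \<in> vars t \<Longrightarrow> (b, X) \<in> \<Delta>'"
  shows "fresh \<Delta>' a t"
  using assms by (induction t) auto

text \<open>A suspended permutation in \<open>t\<close> fixes \<open>c\<close>, so its inverse never
  sends \<open>a\<close> to \<open>c\<close>: the derivation consults no constraint on
  \<open>c\<close>.\<close>

lemma fresh_remove_atom:
  assumes "fresh \<Delta> a t" "a \<noteq> c" "c \<notin> atoms t"
    and "\<And>b X. (b, X) \<in> \<Delta> \<Longrightarrow> b \<noteq> c \<Longrightarrow> (b, X) \<in> \<Delta>'"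
  shows "fresh \<Delta>' a t"
  using assms
  by (induction t) (auto simp: in_affected)

lemma fresh_absent_atom:
  assumes "c \<notin> atoms t" "\<And>X. (c, X) \<in> \<Delta>"
  shows "fresh \<Delta> c t"
  using assms
proof (induction t)
  case (Susp q X)
  then have "inverse q \<langle>$\<rangle> c = c" by (simp add: in_affected)
  \<comment> \<open>\<open>simp only\<close> keeps the equation usable as a rewrite rule;
    \<open>inverse_apply_eq_iff\<close> would turn it into one about \<open>q\<close>.\<close>
  with assms(2) show ?case by (simp only: fresh_simps)
qed auto

lemma alpha_fresh_weaken:
  assumes "alpha_fresh \<Delta> s t" "\<And>b X. (b, X) \<in> \<Delta> \<Longrightarrow> X \<in> vars s \<union> vars t \<Longrightarrow> (b, X) \<in> \<Delta>'"
  shows "alpha_fresh \<Delta>' s t"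
  using assms
proof (induction rule: alpha_fresh.induct)
  case (alpha_fresh_Tup ss ts)
  have "list_all2 (alpha_fresh \<Delta>') ss ts"
    using alpha_fresh_Tup.IH
    by (rule list.rel_mono_strong) (use alpha_fresh_Tup.prems in auto)
  then show ?case
    by (rule alpha_fresh.alpha_fresh_Tup)
next
  case (alpha_fresh_Abst_diff a b s t)
  then show ?case
    by (auto intro!: alpha_fresh.alpha_fresh_Abst_diff elim: fresh_weaken)
qed (auto intro: alpha_fresh.intros)

lemma fresh_of_fix_append:
  assumes "c \<notin> atoms t" "a \<noteq> c"
  shows "fresh (fresh_of_fix \<Upsilon> (cs @ [c])) a t \<longleftrightarrow> fresh (fresh_of_fix \<Upsilon> cs) a t"
proof
  show "fresh (fresh_of_fix \<Upsilon> cs) a t" if "fresh (fresh_of_fix \<Upsilon> (cs @ [c])) a t"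
    using that assms(2,1) by (rule fresh_remove_atom) (auto simp: fresh_of_fix_def)
qed (erule fresh_weaken, auto simp: fresh_of_fix_def)

lemma fresh_of_fix_new:
  "c \<notin> atoms t \<Longrightarrow> fresh (fresh_of_fix \<Upsilon> (cs @ [c])) c t"
  by (rule fresh_absent_atom) (simp_all add: fresh_of_fix_def)

text \<open>This matches the premise of \<open>fixpt_Abst\<close> with the freshness rules for
  abstractions: the swap sends \<open>b\<close> to the quantified \<open>c\<close>, which is fresh
  for \<open>t\<close>, and leaves every other \<open>a\<close> in place.\<close>

lemma fresh_of_fix_swap:
  assumes "c \<notin> atoms t" "a \<noteq> c" "b \<noteq> c"
  shows "fresh (fresh_of_fix \<Upsilon> (cs @ [c])) a (\<langle>b \<leftrightarrow> c\<rangle> \<bullet> t)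
    \<longleftrightarrow> a = b \<or> fresh (fresh_of_fix \<Upsilon> cs) a t"
  using assms by (cases "a = b") (auto simp: fresh_act fresh_of_fix_append fresh_of_fix_new)

text \<open>Conjugating by \<open>inverse q\<close> maps the support through
  \<open>inverse q\<close>, so the side condition is the freshness rule for suspensions at each
  moved atom.\<close>

lemma fixpt_Susp_iff:
  "affected (conjugate p (inverse q)) - set cs \<subseteq> supp_ctx \<Upsilon> X
    \<longleftrightarrow> (\<forall>a\<in>affected p. (inverse q \<langle>$\<rangle> a, X) \<in> fresh_of_fix \<Upsilon> cs)"
proof -
  have "affected (conjugate p (inverse q)) = (\<langle>$\<rangle>) (inverse q) ` affected p"
    by (auto simp: conjugate_def in_affected apply_times image_iff)
  then show ?thesis
    by (auto simp: fresh_of_fix_def)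
qed

lemma fresh_if_fixpt:
  assumes "fixpt \<Upsilon> cs p t" "a \<in> affected p"
  shows "fresh (fresh_of_fix \<Upsilon> cs) a t"
  using assms
proof (induction rule: fixpt.induct)
  case (fixpt_Susp p q cs X)
  then show ?case
    by (simp add: fixpt_Susp_iff)
next
  case (fixpt_Abst cs c p b t)
  \<comment> \<open>The new atom \<open>c\<close> avoids \<open>affected p\<close>, which contains
    \<open>a\<close>.\<close>
  then have "a \<noteq> c" by blast
  with fixpt_Abst fresh_of_fix_swap [of c t a b] show ?case
    by auto
qed (auto simp: in_affected)

lemma fixpt_if_fresh:
  fixes t :: "('a::infinite, 'x, 'f) trm"
  assumes "finite \<Upsilon>" "\<And>a. a \<in> affected p \<Longrightarrow> fresh (fresh_of_fix \<Upsilon> cs) a t"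
  shows "fixpt \<Upsilon> cs p t"
proof -
  \<comment> \<open>The premise of \<open>fixpt_Abst\<close> concerns a renamed body, not a subterm,
    so the structural induction is generalized over a permutation \<open>r\<close> and the prefix
    \<open>cs\<close>.\<close>
  have "(\<And>a. a \<in> affected p \<Longrightarrow> fresh (fresh_of_fix \<Upsilon> cs) a (r \<bullet> t)) \<Longrightarrow> fixpt \<Upsilon> cs p (r \<bullet> t)" for r
  proof (induction t arbitrary: r cs)
    case (Atm b)
    then show ?case
      by (auto simp: in_affected intro!: fixpt.intros)
  next
    case (Abst b t)
    let ?A = "atoms_ctx \<Upsilon> \<union> set cs \<union> affected p \<union> atoms (Abst (r \<langle>$\<rangle> b) (r \<bullet> t))"
    have "finite ?A"
      using \<open>finite \<Upsilon>\<close> by (auto simp: atoms_ctx_def finite_atoms)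
    then obtain c where c: "c \<notin> ?A"
      by (rule exE [OF arb_element])
    have "fresh (fresh_of_fix \<Upsilon> (cs @ [c])) a (\<langle>r \<langle>$\<rangle> b \<leftrightarrow> c\<rangle> \<bullet> r \<bullet> t)" if "a \<in> affected p" for a
      using that c Abst.prems [OF that] by (subst fresh_of_fix_swap) auto
    then have "fixpt \<Upsilon> (cs @ [c]) p (\<langle>r \<langle>$\<rangle> b \<leftrightarrow> c\<rangle> \<bullet> r \<bullet> t)"
      \<comment> \<open>The swap is absorbed into \<open>r\<close>, which makes the induction
        hypothesis applicable with prefix \<open>cs @ [c]\<close>.\<close>
      unfolding act_act by (rule Abst.IH)
    with c show ?case
      by (simp add: fixpt_Abst)
  next
    case (Tup ts)
    then show ?case
      by (auto intro!: fixpt_Tup)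
  next
    case (Fun f t)
    then show ?case
      by (auto intro!: fixpt_Fun)
  next
    case (Susp q X)
    then have "affected (conjugate p (inverse (r * q))) - set cs \<subseteq> supp_ctx \<Upsilon> X"
      by (simp add: fixpt_Susp_iff del: perm.inverse_distrib_swap)
    then show ?case
      by (simp add: fixpt_Susp)
  qed
  from this [of 1] assms(2) show ?thesis
    by simp
qed

text \<open>The atoms moved by \<open>inverse q * p\<close> are exactly those on which
  \<open>p\<close> and \<open>q\<close> disagree.\<close>

lemma alpha_fix_Susp_iff:
  "affected (inverse q * p) - set cs \<subseteq> supp_ctx \<Upsilon> X
    \<longleftrightarrow> (\<forall>a. p \<langle>$\<rangle> a \<noteq> q \<langle>$\<rangle> a \<longrightarrow> (a, X) \<in> fresh_of_fix \<Upsilon> cs)"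
  unfolding subset_iff by (simp add: in_affected apply_times fresh_of_fix_def) metis

lemma alpha_fresh_if_alpha_fix:
  assumes "alpha_fix \<Upsilon> cs s t"
  shows "alpha_fresh (fresh_of_fix \<Upsilon> cs) s t"
  using assms
proof (induction rule: alpha_fix.induct)
  case (alpha_fix_Susp q p cs X)
  then show ?case
    unfolding alpha_fix_Susp_iff by (rule alpha_fresh_Susp)
next
  case (alpha_fix_Tup cs ss ts)
  then show ?case
    by (auto intro!: alpha_fresh_Tup elim: list.rel_mono_strong)
next
  case (alpha_fix_Abst_diff a b cs s t c)
  then have "a \<noteq> c" "c \<notin> atoms t" by auto
  \<comment> \<open>The swap of \<open>a\<close> and \<open>c\<close> moves \<open>a\<close>;
    afterwards \<open>fresh_of_fix_append\<close> drops \<open>c\<close> from the prefix.\<close>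
  moreover have "fresh (fresh_of_fix \<Upsilon> (cs @ [c])) a t"
    using alpha_fix_Abst_diff.hyps \<open>a \<noteq> c\<close> by (auto intro: fresh_if_fixpt simp: affected_swap)
  ultimately show ?case
    using alpha_fix_Abst_diff by (auto simp: fresh_of_fix_append intro: alpha_fresh.intros)
qed (auto intro: alpha_fresh.intros)

lemma alpha_fix_if_alpha_fresh:
  fixes s t :: "('a::infinite, 'x, 'f) trm"
  assumes "finite \<Upsilon>" "alpha_fresh (fresh_of_fix \<Upsilon> cs) s t"
  shows "alpha_fix \<Upsilon> cs s t"
  using assms(2)
proof (induction rule: alpha_fresh.induct)
  case (alpha_fresh_Susp p q X)
  then show ?case
    by (metis alpha_fix_Susp alpha_fix_Susp_iff)
next
  case (alpha_fresh_Tup ss ts)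
  then show ?case
    by (auto intro!: alpha_fix_Tup elim: list.rel_mono_strong)
next
  case (alpha_fresh_Abst_diff a b s t)
  let ?A = "atoms_ctx \<Upsilon> \<union> set cs \<union> atoms (Abst a s) \<union> atoms (Abst b t)"
  have "finite ?A"
    using \<open>finite \<Upsilon>\<close> by (auto simp: atoms_ctx_def finite_atoms)
  then obtain c where c: "c \<notin> ?A"
    by (rule exE [OF arb_element])
  then have "a \<noteq> c" "c \<notin> atoms t" by auto
  \<comment> \<open>The swap moves only \<open>a\<close>, fresh by the rule's premise, and
    \<open>c\<close>, fresh because it is quantified and absent from \<open>t\<close>.\<close>
  with alpha_fresh_Abst_diff have "fixpt \<Upsilon> (cs @ [c]) \<langle>a \<leftrightarrow> c\<rangle> t"
    by (intro fixpt_if_fresh \<open>finite \<Upsilon>\<close>) (auto simp: affected_swap fresh_of_fix_append fresh_of_fix_new)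
  with alpha_fresh_Abst_diff.hyps(1) alpha_fresh_Abst_diff.IH c show ?case
    by (metis alpha_fix_Abst_diff)
qed (auto intro: alpha_fix.intros)

lemma fresh_of_fix_empty: "fresh_of_fix {} [] = {}"
  by (simp add: fresh_of_fix_def supp_ctx_def)

text \<open>Newness gives \<open>c a \<noteq> a\<close>, so the swap really moves \<open>a\<close>.
  It also moves \<open>c a\<close>, hence only an inclusion, which suffices for weakening.\<close>

lemma subset_fresh_of_to_fix:
  assumes "new_atoms c \<Delta> s t"
  shows "\<Delta> \<subseteq> fresh_of_fix (to_fix c \<Delta>) []"
proof clarify
  fix a X assume aX: "(a, X) \<in> \<Delta>"
  then have "a \<in> fst ` \<Delta>" by force
  with assms have "c a \<noteq> a" by (force simp: new_atoms_def)
  then have "a \<in> affected \<langle>a \<leftrightarrow> c a\<rangle>" by (simp add: in_affected)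
  moreover have "(\<langle>a \<leftrightarrow> c a\<rangle>, X) \<in> to_fix c \<Delta>"
    using aX unfolding to_fix_def by blast
  ultimately show "(a, X) \<in> fresh_of_fix (to_fix c \<Delta>) []"
    unfolding fresh_of_fix_def supp_ctx_def by blast
qed

lemma finite_to_fix: "finite \<Delta> \<Longrightarrow> finite (to_fix c \<Delta>)"
proof -
  have "to_fix c \<Delta> = (\<lambda>(a, X). (\<langle>a \<leftrightarrow> c a\<rangle>, X)) ` \<Delta>"
    by (auto simp: to_fix_def image_iff)
  then show "finite \<Delta> \<Longrightarrow> finite (to_fix c \<Delta>)" by simp
qed

theorem theorem3p16:
  fixes s t :: "('a::{countable,infinite}, 'x::{countable,infinite}, 'f::countable) trm"
  shows
    "(ground s \<and> ground t \<longrightarrow> (alpha_fresh {} s t \<longleftrightarrow> alpha_fix {} [] s t))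
     \<and> (\<forall>\<Delta> c. finite \<Delta> \<and> new_atoms c \<Delta> s t \<and> alpha_fresh \<Delta> s t
           \<longrightarrow> alpha_fix (to_fix c \<Delta>) [] s t)
     \<and> (\<forall>\<Upsilon> cs \<Delta>. finite \<Upsilon> \<and> finite \<Delta> \<and> alpha_fix \<Upsilon> cs s t
           \<and> (\<forall>d\<in>set cs. \<forall>X\<in>vars s \<union> vars t.
                fresh \<Delta> d (Susp 1 X :: ('a, 'x, 'f) trm))
           \<longrightarrow> alpha_fresh (to_fresh \<Upsilon> \<union> \<Delta>) s t)"
proof (intro conjI allI impI; (elim conjE)?)
  show "alpha_fresh {} s t \<longleftrightarrow> alpha_fix {} [] s t"
    using alpha_fresh_if_alpha_fix [of "{}" "[]" s t] alpha_fix_if_alpha_fresh [of "{}" "[]" s t]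
    by (auto simp: fresh_of_fix_empty)
next
  fix \<Delta> c
  assume "finite \<Delta>" "new_atoms c \<Delta> s t" "alpha_fresh \<Delta> s t"
  moreover from this(2) have "\<Delta> \<subseteq> fresh_of_fix (to_fix c \<Delta>) []"
    by (rule subset_fresh_of_to_fix)
  ultimately have "alpha_fresh (fresh_of_fix (to_fix c \<Delta>) []) s t"
    by (elim alpha_fresh_weaken) (rule subsetD)
  then show "alpha_fix (to_fix c \<Delta>) [] s t"
    using \<open>finite \<Delta>\<close> by (intro alpha_fix_if_alpha_fresh finite_to_fix)
next
  fix \<Upsilon> cs and \<Delta> :: "('a, 'x) fresh_ctx"
  assume "alpha_fix \<Upsilon> cs s t"
    and "\<forall>d\<in>set cs. \<forall>X\<in>vars s \<union> vars t. fresh \<Delta> d (Susp 1 X :: ('a, 'x, 'f) trm)"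
  \<comment> \<open>Constraints from \<open>supp_ctx\<close> lie in
    \<open>to_fresh \<Upsilon>\<close>; those from \<open>cs\<close> lie in \<open>\<Delta>\<close>
    for the variables of \<open>s\<close> and \<open>t\<close>.\<close>
  then show "alpha_fresh (to_fresh \<Upsilon> \<union> \<Delta>) s t"
    by (intro alpha_fresh_weaken [OF alpha_fresh_if_alpha_fix])
      (auto simp: fresh_of_fix_def supp_ctx_def to_fresh_def)
qed

end
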